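(* Let $G=(V,E)$ be a directed graph with $n$ nodes and $m$ edges, let $v_i\in V$ be a source node and let $\varepsilon$ be the maximum error parameter. The total running time of the basic ExactSim algorithm on input $(G,v_i,\varepsilon)$ is bounded by $$O(mL+R)=O\left(\frac{\log n}{\varepsilon^2}+m\log\frac1\varepsilon\right),$$ and its space overhead (space used in addition to the graph) is bounded by $$O(nL)=O\left(n\log\frac1\varepsilon\right),$$ where $L=\lceil\log_{1/c}(2/\varepsilon)\rceil$ is the number of iterations and $R=\frac{6\log n}{(1-\sqrt{c})^4\varepsilon^2}$ is the sample-size parameter of the algorithm, and $c$ is the SimRank decay factor.
   Context: The decay factor $c\in(0,1)$ is a fixed constant (typically $0.6$ or $0.8$). For a node $v$, $\mathcal{I}(v)$ is its set of in-neighbors and $d_{in}(v)=|\mathcal{I}(v)|$. The (reverse) transition matrix $P$ is the $n\times n$ matrix with $P(i,j)=1/d_{in}(v_j)$ if $v_i\in\mathcal{I}(v_j)$ and $P(i,j)=0$ otherwise. $\vec{e}_i$ is the $i$-th standard basis column vector. A $\sqrt{c}$-walk from a node is a random walk which at each step moves to a random in-neighbor of the current node with probability $\sqrt{c}$ and stops at the current node with probability $1-\sqrt{c}$. Two $\sqrt c$-walks started from the same node $v_k$ are said to meet if for some $\ell\ge 1$ both visit the same node at their $\ell$-th step. The basic ExactSim algorithm with input $(G,v_i,\varepsilon)$: (1) Set $L=\lceil\log_{1/c}(2/\varepsilon)\rceil$. (2) Compute iteratively and store $\vec{\pi}_i^{\,0}=(1-\sqrt{c})\vec{e}_i$ and $\vec{\pi}_i^{\,\ell}=\sqrt{c}P\,\vec{\pi}_i^{\,\ell-1}$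 for $\ell=1,\dots,L$, and set $\vec{\pi}_i=\sum_{\ell=0}^{L}\vec{\pi}_i^{\,\ell}$. (3) Set $R=\frac{6\log n}{(1-\sqrt{c})^4\varepsilon^2}$. (4) For each $k=1,\dots,n$, set $R(k)=\lceil R\,\vec{\pi}_i(k)\rceil$. Start with $\hat D(k,k)=0$, sample $R(k)$ pairs of independent $\sqrt{c}$-walks from $v_k$, and add $1/R(k)$ to $\hat D(k,k)$ for each pair that does not meet. Let $\hat D$ be the diagonal matrix with these entries. (5) Set $\vec{s}^{0}=\frac{1}{1-\sqrt{c}}\hat D\,\vec{\pi}_i^{\,L}$ and, for $\ell=1,\dots,L$, set $\vec{s}^{\ell}=\sqrt{c}\,P^{\top}\vec{s}^{\ell-1}+\frac{1}{1-\sqrt{c}}\hat D\,\vec{\pi}_i^{\,L-\ell}$, clearing $\vec{s}^{\ell-1}$ once $\vec{s}^{\ell}$ is computed. Output $\vec{s}^{L}$. Cost accounting used: computing and storing each vector $\vec{\pi}_i^{\,\ell}$ takes $O(m)$ time and $O(n)$ space; computing each $\vec{s}^{\ell}$ takes $O(m)$ time; the total number of simulated pairs of $\sqrt{c}$-walks is counted as $R$, and simulating each $\sqrt{c}$-walk is counted as $O(1)$ time. *)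

theory Defs
  imports
    "HOL-Probability.Probability"
    "HOL-Library.Landau_Symbols"
    "HOL-Library.Monad_Syntax"
    "Jordan_Normal_Form.Matrix"
    "Graph_Theory.Pair_Digraph"
begin

unbundle no vec_syntax

section \<open>Graphs\<close>

text \<open>
  The nodes of a graph with \<open>n\<close> nodes are numbered \<open>0, \<dots>, n - 1\<close>, so that they can serve as
  indices of vectors and matrices. There are no parallel arcs; loops are permitted, and a node
  may have no in-neighbour.
\<close>

type_synonym digraph = "nat pair_pre_digraph"

abbreviation num_nodes :: "digraph \<Rightarrow> nat" where
  "num_nodes G \<equiv> card (pverts G)"

abbreviation num_arcs :: "digraph \<Rightarrow> nat" where
  "num_arcs G \<equiv> card (parcs G)"

definition numbered_digraph :: "digraph \<Rightarrow> bool" where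
  "numbered_digraph G \<longleftrightarrow> pair_fin_digraph G \<and> pverts G = {..<num_nodes G}"

definition in_nbrs :: "digraph \<Rightarrow> nat \<Rightarrow> nat set" where
  "in_nbrs G v = {u. (u, v) \<in> parcs G}"

definition d_in :: "digraph \<Rightarrow> nat \<Rightarrow> nat" where
  "d_in G v = card (in_nbrs G v)"

definition transition_mat :: "digraph \<Rightarrow> real mat" where
  "transition_mat G = Matrix.mat (num_nodes G) (num_nodes G)
     (\<lambda>(i, j). if i \<in> in_nbrs G j then 1 / real (d_in G j) else 0)"


section \<open>Random walks\<close>

text \<open>
  The moves of a walk before the first decision to stop are counted by a geometric distribution;
  \<open>sqrt_c_walk_unfold\<close> below gives the step-by-step description. A walk that is to move from a
  node without in-neighbours ends there. The result is the list of visited nodes, so that the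
  entry at position \<open>\<ell>\<close> is the node visited at the \<open>\<ell>\<close>-th step.
\<close>

primrec walk_moves :: "digraph \<Rightarrow> nat \<Rightarrow> nat \<Rightarrow> nat list pmf" where
  "walk_moves G 0 v = return_pmf [v]"
| "walk_moves G (Suc l) v =
     (if in_nbrs G v = {} then return_pmf [v]
      else do { u \<leftarrow> pmf_of_set (in_nbrs G v); w \<leftarrow> walk_moves G l u; return_pmf (v # w) })"

definition sqrt_c_walk :: "real \<Rightarrow> digraph \<Rightarrow> nat \<Rightarrow> nat list pmf" where
  "sqrt_c_walk c G v = do { l \<leftarrow> geometric_pmf (1 - sqrt c); walk_moves G l v }"

lemma geometric_pmf_unfold:
  assumes "0 < p" "p \<le> 1"
  shows "geometric_pmf p =
    do { b \<leftarrow> bernoulli_pmf (1 - p);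
         if b then map_pmf Suc (geometric_pmf p) else return_pmf 0 }"
proof (rule pmf_eqI)
  fix n
  have "pmf (map_pmf Suc (geometric_pmf p)) n = (if n = 0 then 0 else (1 - p) ^ (n - 1) * p)"
  proof (cases n)
    case 0
    then show ?thesis by (simp add: pmf_eq_0_set_pmf)
  next
    case (Suc k)
    then show ?thesis using assms by (simp add: pmf_map_inj')
  qed
  then show "pmf (geometric_pmf p) n = pmf (do { b \<leftarrow> bernoulli_pmf (1 - p);
      if b then map_pmf Suc (geometric_pmf p) else return_pmf 0 }) n"
    using assms by (cases n) (simp_all add: pmf_bind)
qed

lemma sqrt_c_walk_unfold:
  assumes "0 < c" "c < 1"
  shows "sqrt_c_walk c G v =
    do { move \<leftarrow> bernoulli_pmf (sqrt c);
         if move then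
           (if in_nbrs G v = {} then return_pmf [v]
            else do { u \<leftarrow> pmf_of_set (in_nbrs G v); w \<leftarrow> sqrt_c_walk c G u; return_pmf (v # w) })
         else return_pmf [v] }"
proof -
  have p: "0 < 1 - sqrt c" "1 - sqrt c \<le> 1" using assms by auto
  have suc: "geometric_pmf (1 - sqrt c) \<bind> (\<lambda>l. walk_moves G (Suc l) v) =
      (if in_nbrs G v = {} then return_pmf [v]
       else do { u \<leftarrow> pmf_of_set (in_nbrs G v); w \<leftarrow> sqrt_c_walk c G u; return_pmf (v # w) })"
    by (auto simp: sqrt_c_walk_def bind_assoc_pmf
        bind_commute_pmf[of "geometric_pmf (1 - sqrt c)"])
  have "sqrt_c_walk c G v = bernoulli_pmf (sqrt c) \<bind> (\<lambda>b.
      (if b then map_pmf Suc (geometric_pmf (1 - sqrt c)) else return_pmf 0)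
        \<bind> (\<lambda>l. walk_moves G l v))"
    unfolding sqrt_c_walk_def by (subst geometric_pmf_unfold[OF p]) (simp add: bind_assoc_pmf)
  also have "\<dots> = bernoulli_pmf (sqrt c) \<bind> (\<lambda>b. if b
      then geometric_pmf (1 - sqrt c) \<bind> (\<lambda>l. walk_moves G (Suc l) v) else return_pmf [v])"
    by (intro bind_pmf_cong refl) (auto simp: bind_map_pmf bind_return_pmf simp del: walk_moves.simps(2))
  finally show ?thesis unfolding suc .
qed

definition walks_meet :: "nat list \<Rightarrow> nat list \<Rightarrow> bool" where
  "walks_meet p q \<longleftrightarrow> (\<exists>l\<ge>1. l < length p \<and> l < length q \<and> p ! l = q ! l)"


section \<open>Randomised programs with metered time and space\<close>

text \<open>
  \<open>live\<close> is the number of memory cells currently in use besides the graph, \<open>peak\<close> the largest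
  number that has been in use at any point so far.
\<close>

record meter =
  time :: nat
  live :: nat
  peak :: nat

definition meter_zero :: meter where
  "meter_zero = \<lparr>time = 0, live = 0, peak = 0\<rparr>"

type_synonym 'a prog = "meter \<Rightarrow> ('a \<times> meter) pmf"

definition return_prog :: "'a \<Rightarrow> 'a prog" where
  "return_prog x = (\<lambda>\<mu>. return_pmf (x, \<mu>))"

definition bind_prog :: "'a prog \<Rightarrow> ('a \<Rightarrow> 'b prog) \<Rightarrow> 'b prog" where
  "bind_prog p f = (\<lambda>\<mu>. bind_pmf (p \<mu>) (\<lambda>(x, \<mu>'). f x \<mu>'))"

adhoc_overloading Monad_Syntax.bind \<rightleftharpoons> bind_prog

definition sample_prog :: "'a pmf \<Rightarrow> 'a prog" where
  "sample_prog D = (\<lambda>\<mu>. map_pmf (\<lambda>x. (x, \<mu>)) D)"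

definition tick :: "nat \<Rightarrow> unit prog" where
  "tick t = (\<lambda>\<mu>. return_pmf ((), \<mu>\<lparr>time := time \<mu> + t\<rparr>))"

definition alloc :: "nat \<Rightarrow> unit prog" where
  "alloc a = (\<lambda>\<mu>. return_pmf ((), \<mu>\<lparr>live := live \<mu> + a, peak := max (peak \<mu>) (live \<mu> + a)\<rparr>))"

definition free :: "nat \<Rightarrow> unit prog" where
  "free a = (\<lambda>\<mu>. return_pmf ((), \<mu>\<lparr>live := live \<mu> - a\<rparr>))"

primrec map_prog :: "('a \<Rightarrow> 'b prog) \<Rightarrow> 'a list \<Rightarrow> 'b list prog" where
  "map_prog f [] = return_prog []"
| "map_prog f (x # xs) = do { y \<leftarrow> f x; ys \<leftarrow> map_prog f xs; return_prog (y # ys) }"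

text \<open>
  The charges of the elementary steps: the time to compute and store one vector
  \<open>\<pi>\<^sub>i\<^sup>\<ell>\<close> (including its addition to the running sum \<open>\<pi>\<^sub>i\<close>), the time to compute one vector
  \<open>s\<^sup>\<ell>\<close>, the time to simulate a single walk, and the number of cells taken by one stored vector
  or diagonal matrix. They are worst-case charges, hence functions of the graph alone.
\<close>

record cost_model =
  pi_time :: "digraph \<Rightarrow> nat"
  s_time :: "digraph \<Rightarrow> nat"
  walk_time :: "digraph \<Rightarrow> nat"
  vec_space :: "digraph \<Rightarrow> nat"


section \<open>The basic ExactSim algorithm\<close>

definition num_iters :: "real \<Rightarrow> real \<Rightarrow> nat" where
  "num_iters c \<epsilon> = nat \<lceil>log (1 / c) (2 / \<epsilon>)\<rceil>"

definition sample_size :: "real \<Rightarrow> digraph \<Rightarrow> real \<Rightarrow> real" where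
  "sample_size c G \<epsilon> = 6 * ln (real (num_nodes G)) / ((1 - sqrt c) ^ 4 * \<epsilon> ^ 2)"

text \<open>The list of the vectors \<open>\<pi>\<^sub>i\<^sup>0, \<dots>, \<pi>\<^sub>i\<^sup>\<ell>\<close>, all of which stay in memory.\<close>

primrec pi_vectors :: "cost_model \<Rightarrow> real \<Rightarrow> digraph \<Rightarrow> nat \<Rightarrow> nat \<Rightarrow> real vec list prog" where
  "pi_vectors cm c G i 0 = do {
     alloc (vec_space cm G);
     tick (pi_time cm G);
     return_prog [(1 - sqrt c) \<cdot>\<^sub>v unit_vec (num_nodes G) i]
   }"
| "pi_vectors cm c G i (Suc l) = do {
     ps \<leftarrow> pi_vectors cm c G i l;
     alloc (vec_space cm G);
     tick (pi_time cm G);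
     return_prog (ps @ [sqrt c \<cdot>\<^sub>v (transition_mat G *\<^sub>v last ps)])
   }"

definition simulate_walk :: "cost_model \<Rightarrow> real \<Rightarrow> digraph \<Rightarrow> nat \<Rightarrow> nat list prog" where
  "simulate_walk cm c G k = do {
     tick (walk_time cm G);
     sample_prog (sqrt_c_walk c G k)
   }"

text \<open>\<open>sample_pairs cm c G k x r d\<close> samples \<open>r\<close> pairs of walks from \<open>k\<close> and adds \<open>x\<close> to \<open>d\<close> for each
  pair that does not meet.\<close>

primrec sample_pairs ::
    "cost_model \<Rightarrow> real \<Rightarrow> digraph \<Rightarrow> nat \<Rightarrow> real \<Rightarrow> nat \<Rightarrow> real \<Rightarrow> real prog" where
  "sample_pairs cm c G k x 0 d = return_prog d"
| "sample_pairs cm c G k x (Suc r) d = do {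
     p \<leftarrow> simulate_walk cm c G k;
     q \<leftarrow> simulate_walk cm c G k;
     sample_pairs cm c G k x r (if walks_meet p q then d else d + x)
   }"

definition estimate_D :: "cost_model \<Rightarrow> real \<Rightarrow> digraph \<Rightarrow> real \<Rightarrow> real vec \<Rightarrow> nat \<Rightarrow> real prog" where
  "estimate_D cm c G R \<pi> k =
     (let Rk = nat \<lceil>R * vec_index \<pi> k\<rceil> in sample_pairs cm c G k (1 / real Rk) Rk 0)"

primrec s_vector ::
    "cost_model \<Rightarrow> real \<Rightarrow> digraph \<Rightarrow> nat \<Rightarrow> real vec list \<Rightarrow> real mat \<Rightarrow> nat \<Rightarrow> real vec prog" where
  "s_vector cm c G L ps D 0 = do {
     alloc (vec_space cm G);
     tick (s_time cm G);
     return_prog ((1 / (1 - sqrt c)) \<cdot>\<^sub>v (D *\<^sub>v (ps ! L)))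
   }"
| "s_vector cm c G L ps D (Suc l) = do {
     s \<leftarrow> s_vector cm c G L ps D l;
     alloc (vec_space cm G);
     tick (s_time cm G);
     free (vec_space cm G);
     return_prog (sqrt c \<cdot>\<^sub>v (transpose_mat (transition_mat G) *\<^sub>v s)
       + (1 / (1 - sqrt c)) \<cdot>\<^sub>v (D *\<^sub>v (ps ! (L - Suc l))))
   }"

definition exact_sim :: "cost_model \<Rightarrow> real \<Rightarrow> digraph \<Rightarrow> nat \<Rightarrow> real \<Rightarrow> real vec prog" where
  "exact_sim cm c G i \<epsilon> = (let n = num_nodes G; L = num_iters c \<epsilon>; R = sample_size c G \<epsilon> in do {
     alloc (vec_space cm G);
     ps \<leftarrow> pi_vectors cm c G i L;
     let \<pi> = Matrix.vec n (\<lambda>k. \<Sum>l\<le>L. vec_index (ps ! l) k);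
     alloc (vec_space cm G);
     ds \<leftarrow> map_prog (estimate_D cm c G R \<pi>) [0..<n];
     let D = mat_diag n (\<lambda>k. ds ! k);
     s_vector cm c G L ps D L
   })"

text \<open>
  All executions of the algorithm with error parameter at most \<open>\<epsilon>\<^sub>0\<close>: an input together with a
  possible output and the final meter of the execution. Bounds over \<open>principal (runs \<dots>)\<close> hold
  uniformly for all inputs and all outcomes of the random choices.
\<close>

definition runs :: "cost_model \<Rightarrow> real \<Rightarrow> real \<Rightarrow> (digraph \<times> nat \<times> real \<times> real vec \<times> meter) set" where
  "runs cm c \<epsilon>\<^sub>0 = {(G, i, \<epsilon>, s, \<mu>). numbered_digraph G \<and> i \<in> pverts G \<and> 0 < \<epsilon> \<and> \<epsilon> \<le> \<epsilon>\<^sub>0 \<and>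
     (s, \<mu>) \<in> set_pmf (exact_sim cm c G i \<epsilon> meter_zero)}"

end

theory Submission
  imports Defs
begin

text \<open>
  Only the number of sampled pairs is not immediate from the program. Since the columns of \<open>P\<close>
  sum to at most \<open>1\<close>, so do the entries of \<open>\<pi>\<^sub>i\<close>, and rounding up adds at most one pair for every
  node \<open>k\<close> with \<open>\<pi>\<^sub>i(k) > 0\<close>. Such a node is the source or the tail of an arc, so
  \<open>\<Sum>\<^sub>k R(k) \<le> R + m + 1\<close>. The remaining \<open>1\<close> is absorbed because either \<open>n = 1\<close>, and then no
  pair is sampled, or \<open>R \<ge> 1\<close>; the term \<open>m\<close> is absorbed by \<open>m L\<close> because \<open>L \<ge> 1\<close>.
\<close>

section \<open>Executions of metered programs\<close>

lemma set_pmf_bind_prog: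
  "(y, \<mu>'') \<in> set_pmf (bind_prog p f \<mu>) \<longleftrightarrow>
     (\<exists>x \<mu>'. (x, \<mu>') \<in> set_pmf (p \<mu>) \<and> (y, \<mu>'') \<in> set_pmf (f x \<mu>'))"
  unfolding bind_prog_def set_bind_pmf by fastforce

lemma set_pmf_return_prog: "(y, \<mu>') \<in> set_pmf (return_prog x \<mu>) \<longleftrightarrow> y = x \<and> \<mu>' = \<mu>"
  by (simp add: return_prog_def)

lemma set_pmf_sample_prog: "(y, \<mu>') \<in> set_pmf (sample_prog D \<mu>) \<longleftrightarrow> y \<in> set_pmf D \<and> \<mu>' = \<mu>"
  by (auto simp: sample_prog_def)

lemma set_pmf_tick: "(y, \<mu>') \<in> set_pmf (tick t \<mu>) \<longleftrightarrow> \<mu>' = \<mu>\<lparr>time := time \<mu> + t\<rparr>"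
  by (simp add: tick_def)

lemma set_pmf_alloc:
  "(y, \<mu>') \<in> set_pmf (alloc a \<mu>) \<longleftrightarrow>
     \<mu>' = \<mu>\<lparr>live := live \<mu> + a, peak := max (peak \<mu>) (live \<mu> + a)\<rparr>"
  by (simp add: alloc_def)

lemma set_pmf_free: "(y, \<mu>') \<in> set_pmf (free a \<mu>) \<longleftrightarrow> \<mu>' = \<mu>\<lparr>live := live \<mu> - a\<rparr>"
  by (simp add: free_def)

lemmas set_pmf_prog = set_pmf_bind_prog set_pmf_return_prog set_pmf_sample_prog set_pmf_tick
  set_pmf_alloc set_pmf_free

text \<open>The results of \<open>f\<close> may be random, but its charge \<open>t x\<close> depends
  on the list element alone, so the final meter is the same in every execution.\<close>

lemma map_prog_meter:
  assumes "(ys, \<mu>') \<in> set_pmf (map_prog f xs \<mu>)"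
    and "\<And>x y \<nu> \<nu>'. (y, \<nu>') \<in> set_pmf (f x \<nu>) \<Longrightarrow> \<nu>' = \<nu>\<lparr>time := time \<nu> + t x\<rparr>"
  shows "\<mu>' = \<mu>\<lparr>time := time \<mu> + (\<Sum>x\<leftarrow>xs. t x)\<rparr>"
  using assms(1)
proof (induction xs arbitrary: ys \<mu> \<mu>')
  case Nil
  then show ?case by (simp add: set_pmf_prog)
next
  case (Cons x xs)
  then obtain y \<nu> zs where "(y, \<nu>) \<in> set_pmf (f x \<mu>)" "(zs, \<mu>') \<in> set_pmf (map_prog f xs \<nu>)"
    by (auto simp: set_pmf_prog)
  with Cons.IH[of zs \<mu>' \<nu>] assms(2)[of y \<nu> x \<mu>] show ?case by simp
qed

text \<open>The outcome of the meeting test only influences the accumulator, never the meter. The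
  accumulator is therefore generalised in the induction and its later values can be
  forgotten.\<close>

lemma sample_pairs_meter:
  assumes "(x, \<mu>') \<in> set_pmf (sample_pairs cm c G k y r d \<mu>)"
  shows "\<mu>' = \<mu>\<lparr>time := time \<mu> + 2 * r * walk_time cm G\<rparr>"
  using assms
proof (induction r arbitrary: d \<mu>)
  case 0
  then show ?case by (simp add: set_pmf_prog)
next
  case (Suc r)
  then obtain e where
    "(x, \<mu>') \<in> set_pmf (sample_pairs cm c G k y r e (\<mu>\<lparr>time := time \<mu> + 2 * walk_time cm G\<rparr>))"
    by (auto simp: set_pmf_prog simulate_walk_def mult_2 add.assoc)
  from Suc.IH[OF this] show ?case by simp
qed

lemma estimate_D_meter:
  assumes "(x, \<mu>') \<in> set_pmf (estimate_D cm c G R \<pi> k \<mu>)"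
  shows "\<mu>' = \<mu>\<lparr>time := time \<mu> + 2 * nat \<lceil>R * vec_index \<pi> k\<rceil> * walk_time cm G\<rparr>"
  using sample_pairs_meter assms unfolding estimate_D_def Let_def by blast

text \<open>Each new vector is allocated before its predecessor is freed, so at most two coexist
  whatever \<open>l\<close> is, and one remains at the end.\<close>

lemma s_vector_meter:
  assumes "(x, \<mu>') \<in> set_pmf (s_vector cm c G L ps D l \<mu>)"
  shows "time \<mu>' = time \<mu> + Suc l * s_time cm G \<and> live \<mu>' = live \<mu> + vec_space cm G \<and>
    peak \<mu>' \<le> max (peak \<mu>) (live \<mu> + 2 * vec_space cm G)"
  using assms
proof (induction l arbitrary: x \<mu>')
  case 0
  then show ?case by (auto simp: set_pmf_prog)
next
  case (Suc l)
  then obtain s \<nu> where "(s, \<nu>) \<in> set_pmf (s_vector cm c G L ps D l \<mu>)"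
    "time \<mu>' = time \<nu> + s_time cm G" "live \<mu>' = live \<nu>"
    "peak \<mu>' = max (peak \<nu>) (live \<nu> + vec_space cm G)"
    by (auto simp: set_pmf_prog)
  with Suc.IH[of s \<nu>] show ?case by auto
qed

section \<open>The vectors \<open>\<pi>\<^sub>i\<^sup>\<ell>\<close>\<close>

text \<open>The pure counterpart of \<open>pi_vectors\<close>: no random choice enters there, so the
  entries can be estimated without reference to executions.\<close>

primrec pi_vec :: "real \<Rightarrow> digraph \<Rightarrow> nat \<Rightarrow> nat \<Rightarrow> real vec" where
  "pi_vec c G i 0 = (1 - sqrt c) \<cdot>\<^sub>v unit_vec (num_nodes G) i"
| "pi_vec c G i (Suc l) = sqrt c \<cdot>\<^sub>v (transition_mat G *\<^sub>v pi_vec c G i l)"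

lemma pi_vectors_meter:
  assumes "(ps, \<mu>') \<in> set_pmf (pi_vectors cm c G i l \<mu>)"
  shows "ps = map (pi_vec c G i) [0..<Suc l] \<and> time \<mu>' = time \<mu> + Suc l * pi_time cm G \<and>
    live \<mu>' = live \<mu> + Suc l * vec_space cm G \<and>
    peak \<mu>' = max (peak \<mu>) (live \<mu> + Suc l * vec_space cm G)"
  using assms
proof (induction l arbitrary: ps \<mu>')
  case 0
  then show ?case by (auto simp: set_pmf_prog)
next
  case (Suc l)
  then obtain qs \<nu> where qs: "(qs, \<nu>) \<in> set_pmf (pi_vectors cm c G i l \<mu>)"
    "ps = qs @ [sqrt c \<cdot>\<^sub>v (transition_mat G *\<^sub>v last qs)]"
    "time \<mu>' = time \<nu> + pi_time cm G" "live \<mu>' = live \<nu> + vec_space cm G"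
    "peak \<mu>' = max (peak \<nu>) (live \<nu> + vec_space cm G)"
    by (auto simp: set_pmf_prog)
  with Suc.IH[of qs \<nu>] show ?case by auto
qed

text \<open>The numbers of sampled pairs are determined by the deterministic vectors, so the time is
  an exact value. The factor \<open>L + 5\<close> counts the running sum, the \<open>L + 1\<close>
  stored vectors, the diagonal matrix, and the two vectors that coexist in the last phase.\<close>

lemma exact_sim_meter:
  assumes "(s, \<mu>) \<in> set_pmf (exact_sim cm c G i \<epsilon> meter_zero)"
  shows "time \<mu> = Suc (num_iters c \<epsilon>) * (pi_time cm G + s_time cm G)
      + 2 * walk_time cm G * (\<Sum>k<num_nodes G. nat \<lceil>sample_size c G \<epsilon> *
          (\<Sum>l\<le>num_iters c \<epsilon>. vec_index (pi_vec c G i l) k)\<rceil>)"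
    and "peak \<mu> \<le> (num_iters c \<epsilon> + 5) * vec_space cm G"
proof -
  define n L R where "n = num_nodes G" and "L = num_iters c \<epsilon>" and "R = sample_size c G \<epsilon>"
  define \<pi> where "\<pi> = (\<lambda>ps :: real vec list. Matrix.vec n (\<lambda>k. \<Sum>l\<le>L. vec_index (ps ! l) k))"
  define \<mu>0 where "\<mu>0 = \<lparr>time = 0, live = vec_space cm G, peak = vec_space cm G\<rparr>"
  obtain ps \<mu>1 ds \<mu>2 where
    ps: "(ps, \<mu>1) \<in> set_pmf (pi_vectors cm c G i L \<mu>0)" and
    ds: "(ds, \<mu>2) \<in> set_pmf (map_prog (estimate_D cm c G R (\<pi> ps)) [0..<n]
      (\<mu>1\<lparr>live := live \<mu>1 + vec_space cm G,
         peak := max (peak \<mu>1) (live \<mu>1 + vec_space cm G)\<rparr>))" and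
    s: "(s, \<mu>) \<in> set_pmf (s_vector cm c G L ps (mat_diag n (\<lambda>k. ds ! k)) L \<mu>2)"
    using assms
    by (auto simp: exact_sim_def Let_def set_pmf_prog meter_zero_def n_def L_def R_def \<pi>_def \<mu>0_def)
  note ps' = pi_vectors_meter[OF ps]
  note ds' = map_prog_meter[OF ds estimate_D_meter]
  note s' = s_vector_meter[OF s]
  \<comment> \<open>The list \<open>ps\<close> has length \<open>Suc L\<close>, so every access
    \<open>ps ! l\<close> with \<open>l <= L\<close> is in range.\<close>
  have \<pi>: "vec_index (\<pi> ps) k = (\<Sum>l\<le>L. vec_index (pi_vec c G i l) k)" if "k < n" for k
    using that ps' by (auto simp: \<pi>_def less_Suc_eq_le simp del: upt_Suc intro!: sum.cong)
  have "(\<Sum>k\<leftarrow>[0..<n]. 2 * nat \<lceil>R * vec_index (\<pi> ps) k\<rceil> * walk_time cm G)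
      = 2 * walk_time cm G * (\<Sum>k<n. nat \<lceil>R * vec_index (\<pi> ps) k\<rceil>)"
    by (simp add: interv_sum_list_conv_sum_set_nat sum_distrib_left lessThan_atLeast0 mult_ac)
  also have "\<dots> = 2 * walk_time cm G *
      (\<Sum>k<n. nat \<lceil>R * (\<Sum>l\<le>L. vec_index (pi_vec c G i l) k)\<rceil>)"
    by (simp add: \<pi>)
  finally show "time \<mu> = Suc (num_iters c \<epsilon>) * (pi_time cm G + s_time cm G)
      + 2 * walk_time cm G * (\<Sum>k<num_nodes G. nat \<lceil>sample_size c G \<epsilon> *
          (\<Sum>l\<le>num_iters c \<epsilon>. vec_index (pi_vec c G i l) k)\<rceil>)"
    using ps' ds' s' unfolding n_def L_def R_def \<mu>0_def by (simp add: algebra_simps)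
  show "peak \<mu> \<le> (num_iters c \<epsilon> + 5) * vec_space cm G"
    using ps' ds' s' unfolding L_def \<mu>0_def by (simp add: algebra_simps)
qed

section \<open>Column sums of the transition matrix; sign, mass and support of the vectors\<close>

lemma numbered_digraph_arcs:
  assumes "numbered_digraph G" "(u, v) \<in> parcs G"
  shows "u < num_nodes G" "v < num_nodes G"
proof -
  interpret pair_fin_digraph G using assms(1) by (simp add: numbered_digraph_def)
  have "pverts G = {..<num_nodes G}" using assms(1) by (simp add: numbered_digraph_def)
  moreover have "u \<in> pverts G" "v \<in> pverts G"
    using assms(2) by (auto dest: in_arcsD1 in_arcsD2)
  ultimately show "u < num_nodes G" "v < num_nodes G" by auto
qed

lemma finite_parcs:
  assumes "numbered_digraph G"
  shows "finite (parcs G)"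
proof -
  interpret pair_fin_digraph G using assms by (simp add: numbered_digraph_def)
  show ?thesis by simp
qed

text \<open>A column has \<open>d_in G j\<close> nonzero entries, each the reciprocal of that
  number. The sum is 1, or 0 if \<open>j\<close> has no in-neighbour, hence only an
  inequality.\<close>

lemma transition_mat_col_sum_le_1:
  assumes "numbered_digraph G" "j < num_nodes G"
  shows "(\<Sum>i<num_nodes G. transition_mat G $$ (i, j)) \<le> 1"
proof -
  have sub: "in_nbrs G j \<subseteq> {..<num_nodes G}"
    using numbered_digraph_arcs[OF assms(1)] by (auto simp: in_nbrs_def)
  have "(\<Sum>i<num_nodes G. transition_mat G $$ (i, j))
      = (\<Sum>i<num_nodes G. if i \<in> in_nbrs G j then 1 / real (d_in G j) else 0)"
    using assms by (intro sum.cong) (auto simp: transition_mat_def)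
  also have "\<dots> = (\<Sum>i\<in>in_nbrs G j. 1 / real (d_in G j))"
    using sub by (simp add: sum.If_cases Int_absorb1)
  also have "\<dots> \<le> 1" by (simp add: d_in_def)
  finally show ?thesis .
qed

lemma dim_transition_mat [simp]:
  "dim_row (transition_mat G) = num_nodes G" "dim_col (transition_mat G) = num_nodes G"
  by (simp_all add: transition_mat_def)

lemma dim_pi_vec [simp]: "dim_vec (pi_vec c G i l) = num_nodes G"
  by (cases l) simp_all

lemma pi_vec_Suc_index:
  assumes "k < num_nodes G"
  shows "vec_index (pi_vec c G i (Suc l)) k
    = sqrt c * (\<Sum>j<num_nodes G. transition_mat G $$ (k, j) * vec_index (pi_vec c G i l) j)"
  using assms by (simp add: scalar_prod_def lessThan_atLeast0)

lemma pi_vec_nonneg: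
  assumes "0 < c" "c < 1" "k < num_nodes G"
  shows "0 \<le> vec_index (pi_vec c G i l) k"
  using assms(3)
proof (induction l arbitrary: k)
  case 0
  then show ?case using assms by (simp add: unit_vec_def)
next
  case (Suc l)
  then show ?case using assms unfolding pi_vec_Suc_index[OF Suc.prems]
    by (intro mult_nonneg_nonneg sum_nonneg) (auto simp: transition_mat_def)
qed

text \<open>Exchanging the sums exposes the column sums of the transition matrix, so each step
  shrinks the total mass by a factor of at least \<open>sqrt c\<close>. Nonnegativity of the entries
  makes the columnwise estimate usable.\<close>

lemma sum_pi_vec_le:
  assumes "0 < c" "c < 1" "numbered_digraph G" "i < num_nodes G"
  shows "(\<Sum>k<num_nodes G. vec_index (pi_vec c G i l) k) \<le> (1 - sqrt c) * sqrt c ^ l"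
proof (induction l)
  case 0
  have "(\<Sum>k<num_nodes G. vec_index (pi_vec c G i 0) k)
      = (\<Sum>k<num_nodes G. if k = i then 1 - sqrt c else 0)"
    by (intro sum.cong) (auto simp: unit_vec_def)
  then show ?case using assms by simp
next
  case (Suc l)
  let ?n = "num_nodes G" and ?v = "pi_vec c G i l"
  have "(\<Sum>k<?n. vec_index (pi_vec c G i (Suc l)) k)
      = sqrt c * (\<Sum>j<?n. (\<Sum>k<?n. transition_mat G $$ (k, j)) * vec_index ?v j)"
    unfolding sum_distrib_right
    by (subst sum.swap) (simp add: pi_vec_Suc_index sum_distrib_left del: pi_vec.simps)
  also have "\<dots> \<le> sqrt c * (\<Sum>j<?n. 1 * vec_index ?v j)"
    using assms
    by (intro mult_left_mono sum_mono mult_right_mono transition_mat_col_sum_le_1 pi_vec_nonneg) auto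
  also have "\<dots> \<le> sqrt c * ((1 - sqrt c) * sqrt c ^ l)"
    using Suc assms by (intro mult_left_mono) auto
  finally show ?case by (simp add: mult_ac)
qed

text \<open>The masses are dominated by a truncated geometric series with value
  \<open>1 - sqrt c ^ Suc L\<close>.\<close>

lemma sum_pi_vec_le_1:
  assumes "0 < c" "c < 1" "numbered_digraph G" "i < num_nodes G"
  shows "(\<Sum>k<num_nodes G. \<Sum>l\<le>L. vec_index (pi_vec c G i l) k) \<le> 1"
proof -
  have "(\<Sum>k<num_nodes G. \<Sum>l\<le>L. vec_index (pi_vec c G i l) k)
      = (\<Sum>l\<le>L. \<Sum>k<num_nodes G. vec_index (pi_vec c G i l) k)"
    by (rule sum.swap)
  also have "\<dots> \<le> (\<Sum>l\<le>L. (1 - sqrt c) * sqrt c ^ l)"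
    by (intro sum_mono sum_pi_vec_le assms)
  also have "\<dots> = 1 - sqrt c ^ Suc L"
    unfolding sum_distrib_left[symmetric] lessThan_Suc_atMost[symmetric]
    by (rule one_diff_power_eq[symmetric])
  also have "\<dots> \<le> 1" using assms by simp
  finally show ?thesis .
qed

text \<open>For \<open>l > 0\<close> a nonzero entry at \<open>k\<close> needs a nonzero entry in
  row \<open>k\<close> of the matrix, that is, an arc leaving \<open>k\<close>. This lets the
  rounding cost be counted by arcs; the number of nodes would be too large for graphs with many
  isolated nodes.\<close>

lemma pi_vec_support:
  assumes "k < num_nodes G" "vec_index (pi_vec c G i l) k \<noteq> 0"
  shows "k \<in> insert i (fst ` parcs G)"
proof (cases l)
  case 0
  then show ?thesis using assms by (auto simp: unit_vec_def split: if_splits)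
next
  case (Suc l')
  have "(\<Sum>j<num_nodes G. transition_mat G $$ (k, j) * vec_index (pi_vec c G i l') j) \<noteq> 0"
    using assms unfolding Suc pi_vec_Suc_index[OF assms(1)] by simp
  then obtain j where "j < num_nodes G" "transition_mat G $$ (k, j) \<noteq> 0"
    by (metis (no_types, lifting) lessThan_iff mult_zero_left sum.neutral)
  then have "(k, j) \<in> parcs G"
    using assms(1) by (auto simp: transition_mat_def in_nbrs_def split: if_splits)
  then show ?thesis by force
qed

section \<open>Counting the sampled pairs\<close>

text \<open>The denominator is at most 1, and the numerator is at least \<open>6 * ln 2\<close>,
  which is at least 4.\<close>

lemma sample_size_ge_1:
  assumes "0 < c" "c < 1" "0 < \<epsilon>" "\<epsilon> < 1" "num_nodes G > 1"
  shows "1 \<le> sample_size c G \<epsilon>"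
proof -
  have "(1 - sqrt c) ^ 4 * \<epsilon> ^ 2 \<le> 1 * 1"
    using assms by (intro mult_mono power_le_one) auto
  moreover have "0 < (1 - sqrt c) ^ 4 * \<epsilon> ^ 2" using assms by simp
  moreover have "ln 2 \<le> ln (real (num_nodes G))" using assms by simp
  moreover have "2 / 3 \<le> ln (2::real)" using ln2_ge_two_thirds .
  ultimately show ?thesis unfolding sample_size_def by (simp add: le_divide_eq)
qed

text \<open>Without rounding the sum is at most \<open>R\<close>; rounding adds at most one for each
  of the at most \<open>m + 1\<close> nodes in the support. The extra 1 is bounded by a second
  \<open>R\<close>.\<close>

lemma sum_samples_le:
  assumes "0 < c" "c < 1" "numbered_digraph G" "i < num_nodes G" "0 < \<epsilon>" "\<epsilon> < 1"
  shows "real (\<Sum>k<num_nodes G. nat \<lceil>sample_size c G \<epsilon> *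
      (\<Sum>l\<le>L. vec_index (pi_vec c G i l) k)\<rceil>) \<le> 2 * sample_size c G \<epsilon> + real (num_arcs G)"
proof (cases "num_nodes G > 1")
  case False
  \<comment> \<open>The source guarantees a node, and \<open>ln 1 = 0\<close> makes \<open>R\<close>
    vanish, so nothing is sampled.\<close>
  then have "num_nodes G = 1" using assms by linarith
  then have "sample_size c G \<epsilon> = 0" by (simp add: sample_size_def)
  then show ?thesis by simp
next
  case True
  define R where "R = sample_size c G \<epsilon>"
  define p where "p k = (\<Sum>l\<le>L. vec_index (pi_vec c G i l) k)" for k
  define S where "S = insert i (fst ` parcs G)"
  have R: "1 \<le> R" unfolding R_def using assms True by (intro sample_size_ge_1) auto
  have S: "finite S" "S \<subseteq> {..<num_nodes G}" "card S \<le> Suc (num_arcs G)"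
    using finite_parcs[OF assms(3)] numbered_digraph_arcs[OF assms(3)] assms(4)
      card_insert_le_m1[of "Suc (num_arcs G)" "fst ` parcs G" i] card_image_le[of "parcs G" fst]
    unfolding S_def by auto
  have p0: "p k \<ge> 0" if "k < num_nodes G" for k
    unfolding p_def using assms that by (intro sum_nonneg pi_vec_nonneg) auto
  have supp: "p k = 0" if "k < num_nodes G" "k \<notin> S" for k
    unfolding p_def using pi_vec_support[of k G c i] that unfolding S_def by (intro sum.neutral) blast
  have "real (\<Sum>k<num_nodes G. nat \<lceil>R * p k\<rceil>) = real (\<Sum>k\<in>S. nat \<lceil>R * p k\<rceil>)"
    using S supp by (intro arg_cong[where f = real] sum.mono_neutral_right) auto
  also have "\<dots> = (\<Sum>k\<in>S. real (nat \<lceil>R * p k\<rceil>))" by simp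
  also have "\<dots> \<le> (\<Sum>k\<in>S. R * p k + 1)"
  proof (intro sum_mono)
    fix k assume "k \<in> S"
    then have "0 \<le> R * p k" using p0[of k] S R by auto
    then show "real (nat \<lceil>R * p k\<rceil>) \<le> R * p k + 1" by linarith
  qed
  also have "\<dots> = R * (\<Sum>k\<in>S. p k) + real (card S)" by (simp add: sum.distrib sum_distrib_left)
  \<comment> \<open>The estimate is substituted inside \<open>R * _ + real (card S)\<close>;
    monotonicity of this context is discharged at the end from \<open>1 <= R\<close>.\<close>
  also have "(\<Sum>k\<in>S. p k) \<le> (\<Sum>k<num_nodes G. p k)" using S p0 by (intro sum_mono2) auto
  also have "\<dots> \<le> 1" unfolding p_def using assms by (intro sum_pi_vec_le_1) auto
  also have "R * 1 + real (card S) \<le> 2 * R + real (num_arcs G)" using R S by linarith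
  finally show ?thesis using R unfolding R_def p_def by simp
qed

section \<open>Asymptotics\<close>

text \<open>Up to the factor \<open>ln (1 / c)\<close>, the number of iterations is
  \<open>ln (1 / \<epsilon>)\<close> plus constants from \<open>ln 2\<close> and from rounding up.
  These are absorbed because \<open>ln (1 / \<epsilon>)\<close> stays above the positive number
  \<open>ln (1 / \<epsilon>\<^sub>0)\<close>.\<close>

lemma num_iters_bounds:
  assumes "0 < c" "c < 1" "0 < \<epsilon>" "\<epsilon> \<le> \<epsilon>\<^sub>0" "\<epsilon>\<^sub>0 < 1"
  shows "1 \<le> num_iters c \<epsilon>" "ln (1 / \<epsilon>) \<le> ln (1 / c) * real (num_iters c \<epsilon>)"
    "real (num_iters c \<epsilon>) \<le>
       ((ln 2 / ln (1 / \<epsilon>\<^sub>0) + 1) / ln (1 / c) + 1 / ln (1 / \<epsilon>\<^sub>0)) * ln (1 / \<epsilon>)"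
proof -
  let ?x = "log (1 / c) (2 / \<epsilon>)"
  have c: "0 < ln (1 / c)" and e0: "0 < ln (1 / \<epsilon>\<^sub>0)" using assms by simp_all
  have le: "ln (1 / \<epsilon>\<^sub>0) \<le> ln (1 / \<epsilon>)" using assms by (simp add: frac_le)
  have split: "ln (2 / \<epsilon>) = ln 2 + ln (1 / \<epsilon>)" using assms by (simp add: ln_div)
  have x: "?x = (ln 2 + ln (1 / \<epsilon>)) / ln (1 / c)" by (simp add: log_def split)
  have "0 < ln (2::real)" by simp
  then have "0 < ?x" unfolding x using c e0 le by (intro divide_pos_pos) linarith+
  then have L: "?x \<le> real (num_iters c \<epsilon>)" "real (num_iters c \<epsilon>) \<le> ?x + 1" "1 \<le> num_iters c \<epsilon>"
    unfolding num_iters_def by linarith+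
  show "1 \<le> num_iters c \<epsilon>" by fact
  have "ln (1 / c) * ?x = ln 2 + ln (1 / \<epsilon>)" unfolding x using c by simp
  then show "ln (1 / \<epsilon>) \<le> ln (1 / c) * real (num_iters c \<epsilon>)"
    using mult_left_mono[OF L(1), of "ln (1 / c)"] c \<open>0 < ln 2\<close> by linarith
  \<comment> \<open>This ratio turns both constants, \<open>ln 2\<close> and the 1 from the ceiling,
    into multiples of \<open>ln (1 / \<epsilon>)\<close>.\<close>
  have one: "1 \<le> ln (1 / \<epsilon>) / ln (1 / \<epsilon>\<^sub>0)" using le e0 by simp
  then have "ln 2 \<le> ln 2 * (ln (1 / \<epsilon>) / ln (1 / \<epsilon>\<^sub>0))"
    using mult_left_mono[OF one, of "ln 2"] by simp
  then have "?x \<le> (ln 2 * (ln (1 / \<epsilon>) / ln (1 / \<epsilon>\<^sub>0)) + ln (1 / \<epsilon>)) / ln (1 / c)"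
    unfolding x using c by (intro divide_right_mono) auto
  then have "real (num_iters c \<epsilon>) \<le> (ln 2 * (ln (1 / \<epsilon>) / ln (1 / \<epsilon>\<^sub>0)) + ln (1 / \<epsilon>)) / ln (1 / c)
      + ln (1 / \<epsilon>) / ln (1 / \<epsilon>\<^sub>0)"
    using L one by linarith
  also have "\<dots> = ((ln 2 / ln (1 / \<epsilon>\<^sub>0) + 1) / ln (1 / c) + 1 / ln (1 / \<epsilon>\<^sub>0)) * ln (1 / \<epsilon>)"
    by (simp add: add_divide_distrib distrib_right)
  finally show "real (num_iters c \<epsilon>) \<le>
       ((ln 2 / ln (1 / \<epsilon>\<^sub>0) + 1) / ln (1 / c) + 1 / ln (1 / \<epsilon>\<^sub>0)) * ln (1 / \<epsilon>)" .
qed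

text \<open>Over a principal filter, "eventually" means everywhere on \<open>S\<close>, so big-O is
  a pointwise inequality with one uniform constant.\<close>

lemma bigo_principalE:
  fixes f g :: "'a \<Rightarrow> real"
  assumes "f \<in> O[principal S](g)"
  obtains C where "0 < C" "\<And>x. x \<in> S \<Longrightarrow> \<bar>f x\<bar> \<le> C * \<bar>g x\<bar>"
  using assms by (auto elim!: landau_o.bigE simp: eventually_principal)

lemma bigo_principalI:
  fixes f g :: "'a \<Rightarrow> real"
  assumes "\<And>x. x \<in> S \<Longrightarrow> \<bar>f x\<bar> \<le> C * \<bar>g x\<bar>"
  shows "f \<in> O[principal S](g)"
  using assms by (intro bigoI[where c = C]) (simp add: eventually_principal)

section \<open>Time and space bounds for all executions\<close>

theorem mainTheorem2:
  fixes c \<epsilon>\<^sub>0 :: real and cm :: cost_model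
  assumes c: "0 < c" "c < 1"
    and eps: "0 < \<epsilon>\<^sub>0" "\<epsilon>\<^sub>0 < 1"
    and pi_time: "(\<lambda>G. real (pi_time cm G)) \<in> O[principal {G. numbered_digraph G}](\<lambda>G. real (num_arcs G))"
    and s_time: "(\<lambda>G. real (s_time cm G)) \<in> O[principal {G. numbered_digraph G}](\<lambda>G. real (num_arcs G))"
    and walk_time: "(\<lambda>G. real (walk_time cm G)) \<in> O[principal {G. numbered_digraph G}](\<lambda>G. 1)"
    and vec_space: "(\<lambda>G. real (vec_space cm G)) \<in> O[principal {G. numbered_digraph G}](\<lambda>G. real (num_nodes G))"
  shows "(\<lambda>(G, i, \<epsilon>, s, \<mu>). real (time \<mu>)) \<in> O[principal (runs cm c \<epsilon>\<^sub>0)](\<lambda>(G, i, \<epsilon>, s, \<mu>).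
             real (num_arcs G) * real (num_iters c \<epsilon>) + sample_size c G \<epsilon>)
       \<and> O[principal (runs cm c \<epsilon>\<^sub>0)](\<lambda>(G, i, \<epsilon>, s, \<mu>).
             real (num_arcs G) * real (num_iters c \<epsilon>) + sample_size c G \<epsilon>)
         = O[principal (runs cm c \<epsilon>\<^sub>0)](\<lambda>(G, i, \<epsilon>, s, \<mu>).
             ln (real (num_nodes G)) / \<epsilon>\<^sup>2 + real (num_arcs G) * ln (1 / \<epsilon>))
       \<and> (\<lambda>(G, i, \<epsilon>, s, \<mu>). real (peak \<mu>)) \<in> O[principal (runs cm c \<epsilon>\<^sub>0)](\<lambda>(G, i, \<epsilon>, s, \<mu>).
             real (num_nodes G) * real (num_iters c \<epsilon>))
       \<and> O[principal (runs cm c \<epsilon>\<^sub>0)](\<lambda>(G, i, \<epsilon>, s, \<mu>).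
             real (num_nodes G) * real (num_iters c \<epsilon>))
         = O[principal (runs cm c \<epsilon>\<^sub>0)](\<lambda>(G, i, \<epsilon>, s, \<mu>).
             real (num_nodes G) * ln (1 / \<epsilon>))"
proof -
  define S where "S = runs cm c \<epsilon>\<^sub>0"
  have S: "numbered_digraph G \<and> i < num_nodes G \<and> 0 < \<epsilon> \<and> \<epsilon> \<le> \<epsilon>\<^sub>0 \<and> \<epsilon> < 1 \<and>
      (s, \<mu>) \<in> set_pmf (exact_sim cm c G i \<epsilon> meter_zero)" if "(G, i, \<epsilon>, s, \<mu>) \<in> S" for G i \<epsilon> s \<mu>
    using that eps by (auto simp: S_def runs_def numbered_digraph_def)
  have R0: "0 \<le> sample_size c G \<epsilon>" and ln0: "0 \<le> ln (real (num_nodes G))"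
    and iters: "1 \<le> num_iters c \<epsilon>" and eps0: "0 \<le> ln (1 / \<epsilon>)"
    if "(G, i, \<epsilon>, s, \<mu>) \<in> S" for G i \<epsilon> s \<mu>
    using S[OF that] c eps num_iters_bounds(1)[of c \<epsilon> \<epsilon>\<^sub>0] by (auto simp: sample_size_def)

  define K where "K = (ln 2 / ln (1 / \<epsilon>\<^sub>0) + 1) / ln (1 / c) + 1 / ln (1 / \<epsilon>\<^sub>0)"
  have lower: "ln (1 / \<epsilon>) \<le> ln (1 / c) * real (num_iters c \<epsilon>)"
    and upper: "real (num_iters c \<epsilon>) \<le> K * ln (1 / \<epsilon>)"
    if "(G, i, \<epsilon>, s, \<mu>) \<in> S" for G i \<epsilon> s \<mu>
    using S[OF that] c eps num_iters_bounds(2,3)[of c \<epsilon> \<epsilon>\<^sub>0] unfolding K_def by auto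
  \<comment> \<open>The ratio between the sample size and \<open>ln n / \<epsilon>\<^sup>2\<close>;
    it depends on \<open>c\<close> alone.\<close>
  define q where "q = 6 / (1 - sqrt c) ^ 4"
  have q: "0 < q" and lc: "0 < ln (1 / c)" using c by (simp_all add: q_def)
  have size: "sample_size c G \<epsilon> = q * (ln (real (num_nodes G)) / \<epsilon>\<^sup>2)" for G \<epsilon>
    by (simp add: sample_size_def q_def)

  let ?time = "\<lambda>(G, i, \<epsilon>, s, \<mu>). real (time \<mu>) :: real"
  let ?peak = "\<lambda>(G, i, \<epsilon>, s, \<mu>). real (peak \<mu>) :: real"
  let ?f = "\<lambda>(G, i :: nat, \<epsilon>, s :: real vec, \<mu> :: meter).
    real (num_arcs G) * real (num_iters c \<epsilon>) + sample_size c G \<epsilon>"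
  let ?f' = "\<lambda>(G :: digraph, i :: nat, \<epsilon>, s :: real vec, \<mu> :: meter).
    ln (real (num_nodes G)) / \<epsilon>\<^sup>2 + real (num_arcs G) * ln (1 / \<epsilon>)"
  let ?g = "\<lambda>(G :: digraph, i :: nat, \<epsilon>, s :: real vec, \<mu> :: meter).
    real (num_nodes G) * real (num_iters c \<epsilon>)"
  let ?g' = "\<lambda>(G :: digraph, i :: nat, \<epsilon>, s :: real vec, \<mu> :: meter).
    real (num_nodes G) * ln (1 / \<epsilon>)"

  obtain Cp where Cp: "0 < Cp" "\<And>G. numbered_digraph G \<Longrightarrow> real (pi_time cm G) \<le> Cp * real (num_arcs G)"
    using pi_time by (elim bigo_principalE) auto
  obtain Cs where Cs: "0 < Cs" "\<And>G. numbered_digraph G \<Longrightarrow> real (s_time cm G) \<le> Cs * real (num_arcs G)"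
    using s_time by (elim bigo_principalE) auto
  obtain Cw where Cw: "0 < Cw" "\<And>G. numbered_digraph G \<Longrightarrow> real (walk_time cm G) \<le> Cw"
    using walk_time by (elim bigo_principalE) auto
  obtain Cv where Cv: "0 < Cv" "\<And>G. numbered_digraph G \<Longrightarrow> real (vec_space cm G) \<le> Cv * real (num_nodes G)"
    using vec_space by (elim bigo_principalE) auto

  have "?time \<in> O[principal S](?f)"
  \<comment> \<open>The first 2 comes from \<open>L + 1 <= 2 * L\<close>. The 4 combines two walks
    per pair with the bound \<open>2 * R + m\<close> on the pairs, where \<open>m\<close> is
    enlarged to \<open>2 * (m * L)\<close> to match the coefficient of \<open>R\<close>.\<close>
  proof (rule bigo_principalI[where C = "2 * (Cp + Cs) + 4 * Cw"], clarify)
    fix G i \<epsilon> s \<mu> assume run: "(G, i, \<epsilon>, s, \<mu>) \<in> S"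
    note S = S[OF run] and R0 = R0[OF run] and iters = iters[OF run]
    define m L R where "m = real (num_arcs G)" and "L = real (num_iters c \<epsilon>)"
      and "R = sample_size c G \<epsilon>"
    define N where "N = real (\<Sum>k<num_nodes G. nat \<lceil>sample_size c G \<epsilon> *
      (\<Sum>l\<le>num_iters c \<epsilon>. vec_index (pi_vec c G i l) k)\<rceil>)"
    have m: "0 \<le> m" and L: "1 \<le> L" and R: "0 \<le> R"
      using iters R0 by (simp_all add: m_def L_def R_def)
    have mL: "m \<le> m * L" using mult_left_mono[OF L m] by simp
    have N: "0 \<le> N" unfolding N_def by (rule of_nat_0_le_iff)
    have N_le: "N \<le> 2 * R + m"
      unfolding N_def R_def m_def using c S by (intro sum_samples_le) auto
    have "real (time \<mu>)
        = (L + 1) * (real (pi_time cm G) + real (s_time cm G)) + 2 * real (walk_time cm G) * N"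
      using exact_sim_meter(1)[of s \<mu> cm c G i \<epsilon>] S unfolding L_def N_def by (simp add: distrib_right)
    also have "\<dots> \<le> (2 * L) * (Cp * m + Cs * m) + 2 * Cw * (2 * R + m)"
      using Cp Cs Cw S N N_le L m R unfolding m_def
      by (intro add_mono mult_mono add_nonneg_nonneg mult_nonneg_nonneg) auto
    also have "\<dots> \<le> (2 * L) * (Cp * m + Cs * m) + 2 * Cw * (2 * R + 2 * (m * L))"
      using mL m L Cw by (intro add_left_mono mult_left_mono) linarith+
    also have "\<dots> \<le> (2 * (Cp + Cs) + 4 * Cw) * (m * L + R)"
      using Cp Cs R by (simp add: algebra_simps)
    finally show "\<bar>real (time \<mu>)\<bar> \<le> (2 * (Cp + Cs) + 4 * Cw) *
        \<bar>real (num_arcs G) * real (num_iters c \<epsilon>) + sample_size c G \<epsilon>\<bar>"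
      using m L R unfolding m_def L_def R_def by simp
  qed
  moreover have "?peak \<in> O[principal S](?g)"
  \<comment> \<open>The 6 comes from \<open>L + 5 <= 6 * L\<close>, valid because
    \<open>L >= 1\<close>.\<close>
  proof (rule bigo_principalI[where C = "6 * Cv"], clarify)
    fix G i \<epsilon> s \<mu> assume run: "(G, i, \<epsilon>, s, \<mu>) \<in> S"
    note S = S[OF run] and iters = iters[OF run]
    have "real (peak \<mu>) \<le> real ((num_iters c \<epsilon> + 5) * vec_space cm G)"
      using exact_sim_meter(2)[of s \<mu> cm c G i \<epsilon>] S by (simp only: of_nat_le_iff)
    also have "\<dots> \<le> (6 * real (num_iters c \<epsilon>)) * (Cv * real (num_nodes G))"
      unfolding of_nat_mult using Cv S iters by (intro mult_mono) auto
    finally show "\<bar>real (peak \<mu>)\<bar> \<le> 6 * Cv * \<bar>real (num_nodes G) * real (num_iters c \<epsilon>)\<bar>"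
      by (simp add: mult_ac)
  qed
  moreover have "?g \<in> \<Theta>[principal S](?g')"
  proof (rule bigthetaI)
    show "?g \<in> O[principal S](?g')"
    proof (rule bigo_principalI[where C = K], clarify)
      fix G i \<epsilon> s \<mu> assume run: "(G, i, \<epsilon>, s, \<mu>) \<in> S"
      show "\<bar>real (num_nodes G) * real (num_iters c \<epsilon>)\<bar> \<le> K * \<bar>real (num_nodes G) * ln (1 / \<epsilon>)\<bar>"
        using mult_left_mono[OF upper[OF run], of "real (num_nodes G)"] eps0[OF run]
        by (simp add: abs_mult mult_ac)
    qed
    show "?g \<in> \<Omega>[principal S](?g')"
      unfolding bigomega_iff_bigo
    proof (rule bigo_principalI[where C = "ln (1 / c)"], clarify)
      fix G i \<epsilon> s \<mu> assume run: "(G, i, \<epsilon>, s, \<mu>) \<in> S"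
      show "\<bar>real (num_nodes G) * ln (1 / \<epsilon>)\<bar>
          \<le> ln (1 / c) * \<bar>real (num_nodes G) * real (num_iters c \<epsilon>)\<bar>"
        using mult_left_mono[OF lower[OF run], of "real (num_nodes G)"] eps0[OF run]
        by (simp add: abs_mult mult_ac)
    qed
  qed
  moreover have "?f \<in> \<Theta>[principal S](?f')"
  proof (rule bigthetaI)
    show "?f \<in> O[principal S](?f')"
    \<comment> \<open>The two summands are compared separately, with \<open>K\<close> for the
      iterations and \<open>q\<close> for the samples; the maximum serves both.\<close>
    proof (rule bigo_principalI[where C = "max K q"], clarify)
      fix G i \<epsilon> s \<mu> assume run: "(G, i, \<epsilon>, s, \<mu>) \<in> S"
      define m A B where "m = real (num_arcs G)" and "A = ln (real (num_nodes G)) / \<epsilon>\<^sup>2"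
        and "B = ln (1 / \<epsilon>)"
      have nn: "0 \<le> m" "0 \<le> A" "0 \<le> B"
        using ln0[OF run] eps0[OF run] by (auto simp: m_def A_def B_def)
      have "m * real (num_iters c \<epsilon>) \<le> m * (K * B)"
        using upper[OF run] nn unfolding B_def by (intro mult_left_mono)
      moreover have "K * (m * B) \<le> max K q * (m * B)" "q * A \<le> max K q * A"
        using nn by (intro mult_right_mono; simp)+
      ultimately have "m * real (num_iters c \<epsilon>) + q * A \<le> max K q * (A + m * B)"
        by (simp add: algebra_simps)
      then show "\<bar>real (num_arcs G) * real (num_iters c \<epsilon>) + sample_size c G \<epsilon>\<bar> \<le> max K q *
          \<bar>ln (real (num_nodes G)) / \<epsilon>\<^sup>2 + real (num_arcs G) * ln (1 / \<epsilon>)\<bar>"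
        unfolding size m_def[symmetric] A_def[symmetric] B_def[symmetric] using nn q by simp
    qed
    show "?f \<in> \<Omega>[principal S](?f')"
      unfolding bigomega_iff_bigo
    \<comment> \<open>Conversely, \<open>ln (1 / c)\<close> recovers the logarithm from the
      iterations, and \<open>1 / q\<close> undoes the sampling factor.\<close>
    proof (rule bigo_principalI[where C = "max (ln (1 / c)) (1 / q)"], clarify)
      fix G i \<epsilon> s \<mu> assume run: "(G, i, \<epsilon>, s, \<mu>) \<in> S"
      define m A B L C where "m = real (num_arcs G)" and "A = ln (real (num_nodes G)) / \<epsilon>\<^sup>2"
        and "B = ln (1 / \<epsilon>)" and "L = real (num_iters c \<epsilon>)" and "C = max (ln (1 / c)) (1 / q)"
      have nn: "0 \<le> m" "0 \<le> A" "0 \<le> B" "0 \<le> L"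
        using ln0[OF run] eps0[OF run] by (auto simp: m_def A_def B_def L_def)
      have "B \<le> C * L"
        using lower[OF run] mult_right_mono[of "ln (1 / c)" C L] nn unfolding B_def L_def C_def by simp
      then have "m * B \<le> m * (C * L)" using nn by (intro mult_left_mono)
      moreover have "1 \<le> C * q" using q mult_right_mono[of "1 / q" C q] by (simp add: C_def)
      then have "1 * A \<le> C * q * A" using nn by (intro mult_right_mono)
      ultimately have "A + m * B \<le> C * (m * L + q * A)"
        by (simp add: algebra_simps)
      then show "\<bar>ln (real (num_nodes G)) / \<epsilon>\<^sup>2 + real (num_arcs G) * ln (1 / \<epsilon>)\<bar>
          \<le> max (ln (1 / c)) (1 / q) *
            \<bar>real (num_arcs G) * real (num_iters c \<epsilon>) + sample_size c G \<epsilon>\<bar>"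
        unfolding size m_def[symmetric] A_def[symmetric] B_def[symmetric] L_def[symmetric]
          C_def[symmetric] using nn q by simp
    qed
  qed
  \<comment> \<open>Functions related by Theta have the same big-O class, which gives both
    equalities.\<close>
  ultimately show ?thesis
    unfolding S_def using landau_o.big.cong_bigtheta by blast
qed

end
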